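(* Let $\mathcal{O}$ be an Okubo algebra with isotropic norm over a field $\mathbb{F}$. Assume that at least one of the following conditions is satisfied: (1) $\mathcal{O}$ does not contain nonzero idempotents; (2) $\operatorname{char}\mathbb{F}\neq 3$ and $\mathbb{F}$ does not contain a primitive cube root of unity; (3) $\operatorname{char}\mathbb{F}=3$, and the algebra $\mathcal{O}$ is not split. Then all shortest paths in the orthogonality graph $\Gamma_O(\mathcal{O})$ are unique. In other words, if $d([x],[y])=k<\infty$ for some $x,y\in Z(\mathcal{O})$, then there exists a unique path of length $k$ between the vertices $[x]$ and $[y]$.
   Context: For a field $\mathbb{F}$ (arbitrary characteristic) and nonzero $\alpha,\beta\in\mathbb{F}$, let $\mathcal{O}_{\alpha,\beta}$ be the $8$-dimensional $\mathbb{F}$-algebra with basis $z_{1,0},z_{2,0},z_{0,1},z_{0,2},z_{1,1},z_{2,2},z_{1,2},z_{2,1}$ and (bilinear, non-associative) multiplication $*$ given by the table (the entry in row $a$, column $b$ is $a*b$): $$\begin{array}{c|cccccccc} * & z_{1,0} & z_{2,0} & z_{0,1} & z_{0,2} & z_{1,1} & z_{2,2} & z_{1,2} & z_{2,1}\\ \hline z_{1,0} & z_{2,0} & 0 & -z_{1,1} & 0 & -z_{2,1} & 0 & 0 & -\alpha z_{0,1}\\ z_{2,0} & 0 & \alpha z_{1,0} & 0 & -z_{2,2} & 0 & -\alpha z_{1,2} & -\alpha z_{0,2} & 0\\ z_{0,1} & 0 & -z_{2,1} & z_{0,2} & 0 & 0 & -\beta z_{2,0} & 0 & -z_{2,2}\\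 z_{0,2} & -z_{1,2} & 0 & 0 & \beta z_{0,1} & -\beta z_{1,0} & 0 & -\beta z_{1,1} & 0\\ z_{1,1} & 0 & -\alpha z_{0,1} & -z_{1,2} & 0 & z_{2,2} & 0 & -\beta z_{2,0} & 0\\ z_{2,2} & -\alpha z_{0,2} & 0 & 0 & -\beta z_{2,1} & 0 & \alpha\beta z_{1,1} & 0 & -\alpha\beta z_{1,0}\\ z_{1,2} & -z_{2,2} & 0 & -\beta z_{1,0} & 0 & 0 & -\alpha\beta z_{0,1} & \beta z_{2,1} & 0\\ z_{2,1} & 0 & -\alpha z_{1,1} & 0 & -\beta z_{2,0} & -\alpha z_{0,2} & 0 & 0 & \alpha z_{1,2}\end{array}$$ By the known classification, the Okubo algebras with isotropic norm over $\mathbb{F}$ are exactly the $\mathbb{F}$-algebras isomorphic to $\mathcal{O}_{\alpha,\beta}$ for some nonzero $\alpha,\beta\in\mathbb{F}$; take this as the definition. The split Okubo algebra is $\mathcal{O}_{1,1}$ (up to isomorphism). $Z(\mathcal{O})$ is the set of zero divisors, i.e. nonzero $a$ such that $a*b=0$ or $b*a=0$ for some nonzero $b$; in $\mathcal{O}$ every zero divisor is two-sided. For $x\neq0$ write $[x]=\mathbb{F}x$. The orthogonality graph $\Gamma_O(\mathcal{O})$ is the undirected graph whose vertices are the lines $[a]$ with $a$ a two-sided zero divisor, two distinct vertices $[a],[b]$ being adjacent if and only if $a*b=b*a=0$; $d$ is the graph distance. *)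

theory Defs
  imports
    "HOL-Analysis.Cartesian_Space"
    "Graph_Theory.Pair_Digraph"
    "Graph_Theory.Shortest_Path"
begin

section \<open>Non-associative algebras over a field\<close>

locale nonassoc_algebra = vector_space scl
  for scl :: "'f::field \<Rightarrow> 'v::ab_group_add \<Rightarrow> 'v" +
  fixes mul :: "'v \<Rightarrow> 'v \<Rightarrow> 'v"
  assumes linear_mult_right: "Vector_Spaces.linear scl scl (\<lambda>b. mul a b)"
    and linear_mult_left: "Vector_Spaces.linear scl scl (\<lambda>a. mul a b)"

definition algebra_isomorphic ::
  "('f::field \<Rightarrow> 'v::ab_group_add \<Rightarrow> 'v) \<Rightarrow> ('v \<Rightarrow> 'v \<Rightarrow> 'v) \<Rightarrow>
   ('f \<Rightarrow> 'w::ab_group_add \<Rightarrow> 'w) \<Rightarrow> ('w \<Rightarrow> 'w \<Rightarrow> 'w) \<Rightarrow> bool" where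
  "algebra_isomorphic scl mul scl' mul' \<longleftrightarrow>
     (\<exists>f. Vector_Spaces.linear scl scl' f \<and> bij f \<and>
          (\<forall>a b. f (mul a b) = mul' (f a) (f b)))"

definition idempotent :: "('v \<Rightarrow> 'v \<Rightarrow> 'v) \<Rightarrow> 'v \<Rightarrow> bool" where
  "idempotent mul e \<longleftrightarrow> mul e e = e"

definition left_zero_divisor :: "('v::zero \<Rightarrow> 'v \<Rightarrow> 'v) \<Rightarrow> 'v \<Rightarrow> bool" where
  "left_zero_divisor mul a \<longleftrightarrow> a \<noteq> 0 \<and> (\<exists>b. b \<noteq> 0 \<and> mul a b = 0)"

definition right_zero_divisor :: "('v::zero \<Rightarrow> 'v \<Rightarrow> 'v) \<Rightarrow> 'v \<Rightarrow> bool" where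
  "right_zero_divisor mul a \<longleftrightarrow> a \<noteq> 0 \<and> (\<exists>b. b \<noteq> 0 \<and> mul b a = 0)"

definition zero_divisors :: "('v::zero \<Rightarrow> 'v \<Rightarrow> 'v) \<Rightarrow> 'v set" where
  "zero_divisors mul = {a. left_zero_divisor mul a \<or> right_zero_divisor mul a}"

definition two_sided_zero_divisors :: "('v::zero \<Rightarrow> 'v \<Rightarrow> 'v) \<Rightarrow> 'v set" where
  "two_sided_zero_divisors mul = {a. left_zero_divisor mul a \<and> right_zero_divisor mul a}"


section \<open>Okubo algebras with isotropic norm\<close>

datatype okubo_index = Z10 | Z20 | Z01 | Z02 | Z11 | Z22 | Z12 | Z21

instance okubo_index :: finite
proof
  have "(UNIV :: okubo_index set) = {Z10, Z20, Z01, Z02, Z11, Z22, Z12, Z21}"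
    using okubo_index.exhaust by blast
  then show "finite (UNIV :: okubo_index set)"
    by (metis finite.emptyI finite_insert)
qed

text \<open>
  The basis vector \<open>z\<^bsub>i,j\<^esub>\<close> is \<open>axis Zij 1\<close>, so that \<open>axis Zij c\<close> is \<open>c z\<^bsub>i,j\<^esub>\<close>.
\<close>

fun okubo_table ::
  "'f::field \<Rightarrow> 'f \<Rightarrow> okubo_index \<Rightarrow> okubo_index \<Rightarrow> 'f ^ okubo_index" where
  "okubo_table \<alpha> \<beta> Z10 Z10 = axis Z20 1"
| "okubo_table \<alpha> \<beta> Z10 Z01 = axis Z11 (- 1)"
| "okubo_table \<alpha> \<beta> Z10 Z11 = axis Z21 (- 1)"
| "okubo_table \<alpha> \<beta> Z10 Z21 = axis Z01 (- \<alpha>)"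
| "okubo_table \<alpha> \<beta> Z20 Z20 = axis Z10 \<alpha>"
| "okubo_table \<alpha> \<beta> Z20 Z02 = axis Z22 (- 1)"
| "okubo_table \<alpha> \<beta> Z20 Z22 = axis Z12 (- \<alpha>)"
| "okubo_table \<alpha> \<beta> Z20 Z12 = axis Z02 (- \<alpha>)"
| "okubo_table \<alpha> \<beta> Z01 Z20 = axis Z21 (- 1)"
| "okubo_table \<alpha> \<beta> Z01 Z01 = axis Z02 1"
| "okubo_table \<alpha> \<beta> Z01 Z22 = axis Z20 (- \<beta>)"
| "okubo_table \<alpha> \<beta> Z01 Z21 = axis Z22 (- 1)"
| "okubo_table \<alpha> \<beta> Z02 Z10 = axis Z12 (- 1)"
| "okubo_table \<alpha> \<beta> Z02 Z02 = axis Z01 \<beta>"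
| "okubo_table \<alpha> \<beta> Z02 Z11 = axis Z10 (- \<beta>)"
| "okubo_table \<alpha> \<beta> Z02 Z12 = axis Z11 (- \<beta>)"
| "okubo_table \<alpha> \<beta> Z11 Z20 = axis Z01 (- \<alpha>)"
| "okubo_table \<alpha> \<beta> Z11 Z01 = axis Z12 (- 1)"
| "okubo_table \<alpha> \<beta> Z11 Z11 = axis Z22 1"
| "okubo_table \<alpha> \<beta> Z11 Z12 = axis Z20 (- \<beta>)"
| "okubo_table \<alpha> \<beta> Z22 Z10 = axis Z02 (- \<alpha>)"
| "okubo_table \<alpha> \<beta> Z22 Z02 = axis Z21 (- \<beta>)"
| "okubo_table \<alpha> \<beta> Z22 Z22 = axis Z11 (\<alpha> * \<beta>)"
| "okubo_table \<alpha> \<beta> Z22 Z21 = axis Z10 (- (\<alpha> * \<beta>))"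
| "okubo_table \<alpha> \<beta> Z12 Z10 = axis Z22 (- 1)"
| "okubo_table \<alpha> \<beta> Z12 Z01 = axis Z10 (- \<beta>)"
| "okubo_table \<alpha> \<beta> Z12 Z22 = axis Z01 (- (\<alpha> * \<beta>))"
| "okubo_table \<alpha> \<beta> Z12 Z12 = axis Z21 \<beta>"
| "okubo_table \<alpha> \<beta> Z21 Z20 = axis Z11 (- \<alpha>)"
| "okubo_table \<alpha> \<beta> Z21 Z02 = axis Z20 (- \<beta>)"
| "okubo_table \<alpha> \<beta> Z21 Z11 = axis Z02 (- \<alpha>)"
| "okubo_table \<alpha> \<beta> Z21 Z21 = axis Z12 \<alpha>"
| "okubo_table \<alpha> \<beta> _ _ = 0"

definition okubo_mult ::
  "'f::field \<Rightarrow> 'f \<Rightarrow> 'f ^ okubo_index \<Rightarrow> 'f ^ okubo_index \<Rightarrow> 'f ^ okubo_index" where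
  "okubo_mult \<alpha> \<beta> x y = (\<Sum>i\<in>UNIV. \<Sum>j\<in>UNIV. (x $ i * y $ j) *s okubo_table \<alpha> \<beta> i j)"

definition isotropic_okubo_algebra ::
  "('f::field \<Rightarrow> 'v::ab_group_add \<Rightarrow> 'v) \<Rightarrow> ('v \<Rightarrow> 'v \<Rightarrow> 'v) \<Rightarrow> bool" where
  "isotropic_okubo_algebra scl mul \<longleftrightarrow>
     nonassoc_algebra scl mul \<and>
     (\<exists>\<alpha> \<beta>. \<alpha> \<noteq> 0 \<and> \<beta> \<noteq> 0 \<and> algebra_isomorphic scl mul (*s) (okubo_mult \<alpha> \<beta>))"

definition split_okubo_algebra ::
  "('f::field \<Rightarrow> 'v::ab_group_add \<Rightarrow> 'v) \<Rightarrow> ('v \<Rightarrow> 'v \<Rightarrow> 'v) \<Rightarrow> bool" where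
  "split_okubo_algebra scl mul \<longleftrightarrow>
     nonassoc_algebra scl mul \<and> algebra_isomorphic scl mul (*s) (okubo_mult 1 1)"

definition primitive_root_of_unity :: "nat \<Rightarrow> 'f::field \<Rightarrow> bool" where
  "primitive_root_of_unity n w \<longleftrightarrow> 0 < n \<and> w ^ n = 1 \<and> (\<forall>m. 0 < m \<and> m < n \<longrightarrow> w ^ m \<noteq> 1)"


section \<open>The orthogonality graph\<close>

definition line :: "('f \<Rightarrow> 'v \<Rightarrow> 'v) \<Rightarrow> 'v \<Rightarrow> 'v set" where
  "line scl a = range (\<lambda>c. scl c a)"

text \<open>
  An undirected simple graph is a digraph whose arcs are ordered pairs of vertices and whose
  arc set is symmetric and loop-free; an undirected edge is a pair of opposite arcs.
  Orthogonality of two lines does not depend on the chosen generators, because the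
  multiplication is bilinear.
\<close>

definition orthogonality_graph ::
  "('f \<Rightarrow> 'v::zero \<Rightarrow> 'v) \<Rightarrow> ('v \<Rightarrow> 'v \<Rightarrow> 'v) \<Rightarrow> 'v set pair_pre_digraph" where
  "orthogonality_graph scl mul =
     \<lparr> pverts = line scl ` two_sided_zero_divisors mul,
       parcs = {(line scl a, line scl b) | a b.
                  a \<in> two_sided_zero_divisors mul \<and> b \<in> two_sided_zero_divisors mul \<and>
                  line scl a \<noteq> line scl b \<and> mul a b = 0 \<and> mul b a = 0} \<rparr>"

text \<open>
  The infimum of the numbers of arcs of the walks from \<open>u\<close> to \<open>v\<close>; it is \<open>\<infinity>\<close> if there is
  no such walk.
\<close>

definition graph_distance :: "'a pair_pre_digraph \<Rightarrow> 'a \<Rightarrow> 'a \<Rightarrow> ereal" where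
  "graph_distance G u v = wf_digraph.\<mu> (with_proj G) (\<lambda>_. 1) u v"

text \<open>
  Paths are sequences of arcs; since arcs are pairs of vertices, such a sequence with given end
  points amounts to its sequence of vertices, which are required to be pairwise distinct.
\<close>

definition path_of_length ::
  "'a pair_pre_digraph \<Rightarrow> nat \<Rightarrow> 'a \<Rightarrow> ('a \<times> 'a) list \<Rightarrow> 'a \<Rightarrow> bool" where
  "path_of_length G k u p v \<longleftrightarrow> pre_digraph.apath (with_proj G) u p v \<and> length p = k"

end

theory Submission
  imports Defs
begin

text \<open>
  \<open>\<O>\<close> is a symmetric composition algebra: \<open>(x*y)*x = n(x) y = x*(y*x)\<close> with associative
  nondegenerate polar form \<open>B\<close>.  If \<open>y*y \<noteq> 0\<close>, then the only line orthogonal to \<open>y\<close> can be that of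
  \<open>y*y\<close>, so its vertex has degree at most one.  Hence the inner vertices of a shortest path are
  lines of elements of square zero, and paths are unique as soon as orthogonality is transitive
  among such lines.  It is, because no three independent elements of square zero with \<open>x\<close>
  orthogonal to \<open>y\<close> and \<open>z\<close> exist:
  \<^item> an element of square zero gives a nonzero idempotent, which excludes case (1);
  \<^item> already two orthogonal independent elements of square zero produce a root of
    \<open>\<epsilon>\<^sup>2 - \<epsilon> + 1\<close>, so that \<open>- \<epsilon>\<close> is a primitive cube root of unity unless the characteristic is 3;
  \<^item> in characteristic 3 the cubic form \<open>g(v) = B(v, v*v)\<close> is additive, and the existence of such
    \<open>x\<close>, \<open>y\<close>, \<open>z\<close> forces \<open>g(\<O>) \<subseteq> F\<^sup>3 + F\<^sup>3 \<delta>\<close> for some \<open>\<delta>\<close>.  Since \<open>\<alpha>\<close>, \<open>\<alpha>\<^sup>2\<close>, \<open>\<beta>\<close> and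
    \<open>\<beta>\<^sup>2\<close> are values of \<open>g\<close>, both \<open>\<alpha>\<close> and \<open>\<beta>\<close> are cubes, and rescaling the basis shows that
    \<open>\<O>\<close> is split.
\<close>

section \<open>Symmetric composition algebras\<close>

lemma cube_add_char3:
  fixes s t :: "'a::comm_ring_1"
  assumes "(3 :: 'a) = 0"
  shows "(s + t) ^ 3 = s ^ 3 + t ^ 3"
proof -
  have "(s + t) ^ 3 = s ^ 3 + t ^ 3 + 3 * (s * s * t + s * t * t)"
    by (simp add: power3_eq_cube algebra_simps)
  then show ?thesis
    by (simp add: assms)
qed

text \<open>
  Assumption \<open>representable\<close> is the nondegeneracy of \<open>B\<close>: in finite dimension every linear form
  is then \<open>B w\<close> for some \<open>w\<close>.
\<close>

locale symmetric_composition_algebra = nonassoc_algebra scl mul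
  for scl :: "'f::field \<Rightarrow> 'v::ab_group_add \<Rightarrow> 'v" (infixr "*\<^sub>F" 75)
    and mul :: "'v \<Rightarrow> 'v \<Rightarrow> 'v" (infixl "\<odot>" 70) +
  fixes N :: "'v \<Rightarrow> 'f" and B :: "'v \<Rightarrow> 'v \<Rightarrow> 'f"
  assumes flexible_left: "(x \<odot> y) \<odot> x = N x *\<^sub>F y"
    and flexible_right: "x \<odot> (y \<odot> x) = N x *\<^sub>F y"
    and polar: "B x y = N (x + y) - N x - N y"
    and B_add_left: "B (x + y) z = B x z + B y z"
    and B_scale_left: "B (c *\<^sub>F x) y = c * B x y"
    and B_assoc: "B (x \<odot> y) z = B x (y \<odot> z)"
    and representable: "Vector_Spaces.linear scl (*) l \<Longrightarrow> \<exists>w. \<forall>v. B w v = l v"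
begin

section \<open>Linear algebra of the form and the product\<close>

lemma B_sym: "B x y = B y x"
  by (simp add: polar add.commute)

lemma B_add_right: "B x (y + z) = B x y + B x z"
  by (metis B_add_left B_sym)

lemma B_scale_right: "B x (c *\<^sub>F y) = c * B x y"
  by (metis B_scale_left B_sym)

lemma B_zero_left [simp]: "B 0 x = 0"
  using B_scale_left[of 0 0 x] by simp

lemma B_zero_right [simp]: "B x 0 = 0"
  using B_sym[of x 0] by simp

lemma B_minus_left: "B (- x) y = - B x y"
  using B_scale_left[of "- 1" x y] by simp

lemma B_minus_right: "B x (- y) = - B x y"
  using B_minus_left B_sym by metis

lemma B_diff_left: "B (x - y) z = B x z - B y z"
  using B_add_left[of x "- y" z] by (simp add: B_minus_left)

lemma B_diff_right: "B x (y - z) = B x y - B x z"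
  using B_diff_left B_sym by metis

lemmas B_linear = B_add_left B_add_right B_scale_left B_scale_right B_minus_left B_minus_right
  B_diff_left B_diff_right

lemma mul_add_left: "(x + y) \<odot> z = x \<odot> z + y \<odot> z"
  and mul_scale_left: "(c *\<^sub>F x) \<odot> z = c *\<^sub>F (x \<odot> z)"
  using linear_mult_left[of z] by (simp_all add: Vector_Spaces.linear_iff)

lemma mul_add_right: "x \<odot> (y + z) = x \<odot> y + x \<odot> z"
  and mul_scale_right: "x \<odot> (c *\<^sub>F z) = c *\<^sub>F (x \<odot> z)"
  using linear_mult_right[of x] by (simp_all add: Vector_Spaces.linear_iff)

lemma mul_zero [simp]: "0 \<odot> x = 0" "x \<odot> 0 = 0"
  using mul_scale_left[of 0 0 x] mul_scale_right[of x 0 0] by simp_all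

lemma mul_minus_left: "(- x) \<odot> y = - (x \<odot> y)"
  using mul_scale_left[of "- 1" x y] by simp

lemma mul_minus_right: "x \<odot> (- y) = - (x \<odot> y)"
  using mul_scale_right[of x "- 1" y] by simp

lemma mul_diff_left: "(x - y) \<odot> z = x \<odot> z - y \<odot> z"
  using mul_add_left[of x "- y" z] by (simp add: mul_minus_left)

lemma mul_diff_right: "x \<odot> (y - z) = x \<odot> y - x \<odot> z"
  using mul_add_right[of x y "- z"] by (simp add: mul_minus_right)

lemmas mul_linear = mul_add_left mul_add_right mul_scale_left mul_scale_right mul_minus_left
  mul_minus_right mul_diff_left mul_diff_right

text \<open>This is the flexible law at x + z minus the laws at x and z. It exchanges the outer
  factors of a product up to a term in \<open>B\<close>; most later computations rest on it and on
  its mirror image \<open>swap_right\<close>.\<close>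

lemma swap_left: "(x \<odot> y) \<odot> z = B x z *\<^sub>F y - (z \<odot> y) \<odot> x"
proof -
  have "N (x + z) *\<^sub>F y = ((x + z) \<odot> y) \<odot> (x + z)"
    by (simp add: flexible_left)
  also have "\<dots> = N x *\<^sub>F y + (x \<odot> y) \<odot> z + (z \<odot> y) \<odot> x + N z *\<^sub>F y"
    by (simp add: mul_linear flexible_left add_ac)
  finally have "(x \<odot> y) \<odot> z = N (x + z) *\<^sub>F y - N x *\<^sub>F y - N z *\<^sub>F y - (z \<odot> y) \<odot> x"
    by (simp add: algebra_simps)
  then show ?thesis
    by (simp add: polar scale_left_diff_distrib)
qed

lemma swap_right: "x \<odot> (y \<odot> z) = B x z *\<^sub>F y - z \<odot> (y \<odot> x)"
proof -
  have "N (x + z) *\<^sub>F y = (x + z) \<odot> (y \<odot> (x + z))"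
    by (simp add: flexible_right)
  also have "\<dots> = N x *\<^sub>F y + x \<odot> (y \<odot> z) + z \<odot> (y \<odot> x) + N z *\<^sub>F y"
    by (simp add: mul_linear flexible_right add_ac)
  finally have "x \<odot> (y \<odot> z) = N (x + z) *\<^sub>F y - N x *\<^sub>F y - N z *\<^sub>F y - z \<odot> (y \<odot> x)"
    by (simp add: algebra_simps)
  then show ?thesis
    by (simp add: polar scale_left_diff_distrib)
qed

section \<open>Elements of square zero and orthogonality\<close>

definition orthogonal :: "'v \<Rightarrow> 'v \<Rightarrow> bool" (infix "\<bottom>" 50) where
  "x \<bottom> y \<longleftrightarrow> x \<odot> y = 0 \<and> y \<odot> x = 0"

definition square_zero :: "'v \<Rightarrow> bool" where
  "square_zero x \<longleftrightarrow> x \<odot> x = 0"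

lemma orthogonal_sym: "x \<bottom> y \<longleftrightarrow> y \<bottom> x"
  by (auto simp: orthogonal_def)

lemma square_zero_norm:
  assumes "square_zero x"
  shows "N x *\<^sub>F y = 0"
proof (cases "x = 0")
  case True
  then show ?thesis
    using flexible_left[of x y] by simp
next
  case False
  then show ?thesis
    using flexible_left[of x x] assms by (simp add: square_zero_def)
qed

lemma square_zero_sandwich:
  assumes "square_zero x"
  shows "(x \<odot> y) \<odot> x = 0" "x \<odot> (y \<odot> x) = 0"
  using square_zero_norm[OF assms] by (simp_all add: flexible_left flexible_right)

lemma B_square_zero_self: "square_zero x \<Longrightarrow> B x x = 0"
  using swap_left[of x x x] by (cases "x = 0") (auto simp: square_zero_def)

lemma B_orthogonal:
  assumes "square_zero x" "x \<bottom> y"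
  shows "B x y = 0"
  using swap_left[of x x y] assms by (cases "x = 0") (auto simp: square_zero_def orthogonal_def)

section \<open>Vectors with prescribed values of the form\<close>

lemma exists_dual:
  assumes "independent S"
  obtains w where "\<And>s. s \<in> S \<Longrightarrow> B w s = h s"
proof -
  interpret pair: vector_space_pair scl "(*) :: 'f \<Rightarrow> 'f \<Rightarrow> 'f"
    by (intro vector_space_pair.intro vector_space_axioms vector_space_over_itself.vector_space_axioms)
  show ?thesis
    using pair.linear_independent_extend[OF assms, of h] representable that by metis
qed

lemma exists_dual1:
  assumes "x \<noteq> 0"
  obtains w where "B w x = 1"
  using exists_dual[of "{x}" "\<lambda>_. 1"] assms by auto

lemma span_pair: "z \<in> span {x, y} \<longleftrightarrow> (\<exists>a b. z = a *\<^sub>F x + b *\<^sub>F y)"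
  by (auto simp: span_insert span_singleton algebra_simps)

lemma exists_dual2:
  assumes "x \<noteq> 0" "y \<notin> span {x}"
  obtains w where "B w x = 0" "B w y = 1"
proof -
  have "independent {x, y}"
    using assms independent_insertI[of y "{x}"] by (simp add: insert_commute)
  have "x \<noteq> y"
    using assms span_base[of x "{x}"] by auto
  from \<open>independent {x, y}\<close> obtain w where w: "B w s = (if s = y then 1 else 0)" if "s \<in> {x, y}" for s
    using exists_dual[of "{x, y}" "\<lambda>s. if s = y then 1 else 0"] by blast
  show ?thesis
    using that[of w] w[of x] w[of y] \<open>x \<noteq> y\<close> by simp
qed

lemma exists_dual3:
  assumes "x \<noteq> 0" "y \<notin> span {x}" "z \<notin> span {x, y}"
  obtains w where "B w x = 0" "B w z = 0" "B w y = 1"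
proof -
  have "independent {x, y}"
    using assms independent_insertI[of y "{x}"] by (simp add: insert_commute)
  then have "independent {z, x, y}"
    using assms independent_insertI[of z "{x, y}"] by simp
  have "x \<noteq> y" "z \<noteq> y"
    using assms span_base[of x "{x}"] span_base[of y "{x, y}"] by auto
  from \<open>independent {z, x, y}\<close> obtain w where w: "B w s = (if s = y then 1 else 0)" if "s \<in> {z, x, y}" for s
    using exists_dual[of "{z, x, y}" "\<lambda>s. if s = y then 1 else 0"] by blast
  show ?thesis
    using that[of w] w[of x] w[of y] w[of z] \<open>x \<noteq> y\<close> \<open>z \<noteq> y\<close> by simp
qed

lemma exists_dual_subspace:
  assumes "subspace S" "v \<notin> S"
  obtains w where "\<And>s. s \<in> S \<Longrightarrow> B w s = 0" "B w v = 1"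
proof -
  obtain T where T: "T \<subseteq> S" "independent T" "S \<subseteq> span T"
    using maximal_independent_subset by blast
  have span_T: "span T = S"
    using T assms(1) by (simp add: span_minimal subset_antisym)
  have "independent (insert v T)"
    using T(2) assms(2) span_T by (simp add: independent_insertI)
  moreover have "v \<notin> T"
    using T(1) assms(2) by auto
  ultimately obtain w where w: "\<And>s. s \<in> insert v T \<Longrightarrow> B w s = (if s = v then 1 else 0)"
    using exists_dual[of "insert v T" "\<lambda>s. if s = v then 1 else 0"] by blast
  have "B w s = 0" if "s \<in> span T" for s
    using that by (induction rule: span_induct_alt) (use w \<open>v \<notin> T\<close> in \<open>auto simp: B_linear\<close>)
  then show ?thesis
    using that[of w] w[of v] span_T by simp
qed

text \<open>With a dual to \<open>y \<odot> y\<close>, the product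
  \<open>((a \<odot> y) \<odot> z) \<odot> y\<close> has two values. Swapping the outer factors
  gives z, and swapping inside the first bracket gives a multiple of
  \<open>y \<odot> y\<close>.\<close>

lemma orthogonal_to_square:
  assumes "y \<odot> y \<noteq> 0" "y \<bottom> z"
  shows "\<exists>c. z = c *\<^sub>F (y \<odot> y)"
proof -
  obtain a where a: "B a (y \<odot> y) = 1"
    using exists_dual1[OF assms(1)] by blast
  have "((a \<odot> y) \<odot> z) \<odot> y = B (a \<odot> y) y *\<^sub>F z"
    using swap_left[of "a \<odot> y" z y] assms(2) by (simp add: orthogonal_def)
  moreover have "(a \<odot> y) \<odot> z = B a z *\<^sub>F y"
    using swap_left[of a y z] assms(2) by (simp add: orthogonal_def)
  ultimately have "z = B a z *\<^sub>F (y \<odot> y)"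
    using a by (simp add: B_assoc mul_linear)
  then show ?thesis ..
qed

text \<open>An element u with \<open>x \<odot> u = 0\<close> is itself a left multiple of x, as a
  swap with a vector dual to x shows. Another swap moves w past x, where it vanishes.\<close>

lemma annihilated_mul:
  assumes "x \<noteq> 0" "x \<odot> u = 0" "w \<odot> x = 0"
  shows "\<exists>c. u \<odot> w = c *\<^sub>F x"
proof -
  obtain a where a: "B a x = 1"
    using exists_dual1[OF assms(1)] by blast
  have "u = (a \<odot> u) \<odot> x"
    using swap_left[of x u a] assms(2) a by (simp add: B_sym)
  then have "u \<odot> w = ((a \<odot> u) \<odot> x) \<odot> w"
    by simp
  also have "\<dots> = B (a \<odot> u) w *\<^sub>F x"
    using swap_left[of "a \<odot> u" x w] assms(3) by simp
  finally show ?thesis ..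
qed

text \<open>If z were not of square zero, x and y would both be multiples of
  \<open>z \<odot> z\<close>. Otherwise a vector b dual to y and vanishing at x and z gives
  \<open>e = x \<odot> b\<close> with \<open>y \<odot> e = x\<close>. Once
  \<open>e \<odot> z = 0\<close> is known, \<open>annihilated_mul\<close> puts x on the line of
  z.\<close>

lemma orthogonal_triple:
  assumes "square_zero x" "square_zero y" "x \<bottom> y" "x \<bottom> z" "y \<bottom> z" "x \<noteq> 0" "y \<notin> span {x}"
  shows "z \<in> span {x, y}"
proof (rule ccontr)
  assume z: "z \<notin> span {x, y}"
  note orth = assms(3-5)[unfolded orthogonal_def]
  have "z \<noteq> 0"
    using z span_zero by auto
  have "square_zero z"
  proof (rule ccontr)
    assume "\<not> square_zero z"
    then obtain a b where ab: "x = a *\<^sub>F (z \<odot> z)" "y = b *\<^sub>F (z \<odot> z)"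
      using orthogonal_to_square[of z x] orthogonal_to_square[of z y] assms(4,5)
      by (auto simp: square_zero_def orthogonal_sym)
    then have "a \<noteq> 0"
      using assms(6) by auto
    with ab have "y = (b / a) *\<^sub>F x"
      by simp
    with assms(7) show False
      by (metis rangeI span_singleton)
  qed
  obtain b where b: "B b x = 0" "B b z = 0" "B b y = 1"
    using exists_dual3[OF assms(6,7) z] by blast
  define e where "e = x \<odot> b"
  define d where "d = z \<odot> b"
  have ye: "y \<odot> e = x"
    using swap_right[of y x b] b orth by (simp add: e_def B_sym)
  have xe: "x \<odot> e = 0"
    using swap_right[of x x b] b assms(1) by (simp add: e_def B_sym square_zero_def)
  have zd: "z \<odot> d = 0"
    using swap_right[of z z b] b \<open>square_zero z\<close> by (simp add: d_def B_sym square_zero_def)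
  have ez: "e \<odot> z = - (d \<odot> x)"
    using swap_left[of x b z] B_orthogonal[OF assms(1,4)] by (simp add: e_def d_def)
  \<comment> \<open>By \<open>ez\<close> the same vector, up to sign, is a multiple of x and a
    multiple of z; independence makes it zero.\<close>
  obtain s where s: "e \<odot> z = s *\<^sub>F x"
    using annihilated_mul[of x e z] assms(6) xe orth by blast
  obtain t where t: "d \<odot> x = t *\<^sub>F z"
    using annihilated_mul[of z d x] \<open>z \<noteq> 0\<close> zd orth by blast
  have "t = 0"
  proof (rule ccontr)
    assume "t \<noteq> 0"
    have "t *\<^sub>F z = (- s) *\<^sub>F x"
      using s t ez by (metis minus_minus scale_minus_left)
    then have "(1 / t) *\<^sub>F (t *\<^sub>F z) = (1 / t) *\<^sub>F ((- s) *\<^sub>F x)"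
      by simp
    then have "z = (- s / t) *\<^sub>F x + 0 *\<^sub>F y"
      using \<open>t \<noteq> 0\<close> by simp
    with z show False
      by (metis span_pair)
  qed
  with t ez have "e \<odot> z = 0"
    by simp
  then obtain r where r: "x = r *\<^sub>F z"
    using annihilated_mul[of z y e] \<open>z \<noteq> 0\<close> orth ye by auto
  then have "r \<noteq> 0"
    using assms(6) by auto
  with r have "z = (1 / r) *\<^sub>F x + 0 *\<^sub>F y"
    by simp
  with z show False
    by (metis span_pair)
qed

text \<open>For a suitable b dual to y, the elements \<open>p = y \<odot> b\<close> and
  \<open>q = b \<odot> y\<close> annihilate each other and satisfy \<open>p \<odot> p = - q\<close>
  and \<open>q \<odot> q = - p\<close>, so - (p + q) is idempotent. It is nonzero because (p + q)
  fixes y by left multiplication.\<close>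

lemma square_zero_imp_idempotent:
  assumes "square_zero y" "y \<noteq> 0"
  shows "\<exists>e. e \<noteq> 0 \<and> idempotent mul e"
proof -
  have y: "y \<odot> y = 0" "B y y = 0" "\<And>u. (y \<odot> u) \<odot> y = 0" "\<And>u. N y *\<^sub>F u = 0"
    using assms(1) B_square_zero_self[OF assms(1)] square_zero_sandwich[OF assms(1)]
      square_zero_norm[OF assms(1)]
    by (simp_all add: square_zero_def)
  obtain b0 where b0: "B b0 y = 1"
    using exists_dual1[OF assms(2)] by blast
  define p0 where "p0 = y \<odot> b0"
  define m where "m = B y (b0 \<odot> b0)"
  \<comment> \<open>The correction along \<open>p0\<close> cancels
    \<open>B y (b0 \<odot> b0)\<close> and keeps \<open>B b y = 1\<close>, since
    \<open>B p0 y = 0\<close>.\<close>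
  define b where "b = b0 - m *\<^sub>F p0"
  have yp0: "y \<odot> p0 = y"
    using swap_right[of y y b0] y b0 by (simp add: p0_def B_sym)
  have "B p0 y = 0"
    using B_assoc[of y b0 y] B_assoc[of y y b0] B_sym[of y "b0 \<odot> y"] B_assoc[of b0 y y] y
    by (simp add: p0_def)
  then have by1: "B b y = 1"
    by (simp add: b_def B_linear b0)
  have "B y (b0 \<odot> p0) = 0"
    using flexible_right[of b0 y] y by (simp add: p0_def B_linear)
  moreover have "B y (p0 \<odot> b0) = 1"
    using B_assoc[of y p0 b0] yp0 b0 by (simp add: B_sym)
  moreover have "B y (p0 \<odot> p0) = 0"
    using B_assoc[of y p0 p0] yp0 \<open>B p0 y = 0\<close> by (simp add: B_sym)
  ultimately have ybb: "B y (b \<odot> b) = 0"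
    by (simp add: b_def B_linear mul_linear m_def)
  define p where "p = y \<odot> b"
  define q where "q = b \<odot> y"
  have Byp: "B y p = 0" and Byq: "B y q = 0" and Bbp: "B b p = 0" and Bbq: "B b q = 0"
    using B_assoc[of y y b] B_assoc[of y b y] B_assoc[of b y b] B_assoc[of b b y] y ybb
    by (simp_all add: p_def q_def B_sym)
  have pb: "p \<odot> b = b - (b \<odot> b) \<odot> y"
    using swap_left[of y b b] by1 by (simp add: p_def B_sym)
  have "((b \<odot> b) \<odot> y) \<odot> y = 0"
    using swap_left[of "b \<odot> b" y y] y ybb by (simp add: B_sym)
  then have pp: "p \<odot> p = - q"
    using swap_left[of y b p] Byp pb by (simp add: mul_linear q_def flip: p_def)
  have qy: "q \<odot> y = y"
    using swap_left[of b y y] by1 y by (simp add: q_def)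
  have qq: "q \<odot> q = - p"
    using swap_left[of b y q] Bbq qy by (simp add: p_def flip: q_def)
  have "q \<odot> b = N b *\<^sub>F y"
    by (simp add: q_def flexible_left)
  then have pq: "p \<odot> q = 0"
    using swap_left[of y b q] Byq y by (simp add: mul_linear flip: p_def)
  have py: "p \<odot> y = 0"
    by (simp add: p_def y)
  have qp: "q \<odot> p = 0"
    using swap_left[of b y p] Bbp py by (simp flip: q_def)
  have "idempotent mul (- (p + q))"
    by (simp add: idempotent_def mul_linear pp qq pq qp)
  moreover have "- (p + q) \<noteq> 0"
  proof
    assume "- (p + q) = 0"
    then have "(p + q) \<odot> y = 0"
      by (metis neg_equal_0_iff_equal mul_zero(1))
    then show False
      using py qy assms(2) by (simp add: mul_linear)
  qed
  ultimately show ?thesis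
    by blast
qed

text \<open>A vector b dual to y and vanishing at x yields scalars \<epsilon> and \<rho> by which
  certain products act on x. The cyclic identity at x, y, b gives \<epsilon> + \<rho> = 1, and two
  evaluations of \<open>x \<odot> (p \<odot> p)\<close> give \<rho> = - \<epsilon> *
  \<epsilon>.\<close>

lemma orthogonal_pair_imp_root:
  assumes cyclic: "\<And>x y z. (x \<odot> y) \<odot> z + (y \<odot> z) \<odot> x + (z \<odot> x) \<odot> y
      = z \<odot> (x \<odot> y) + x \<odot> (y \<odot> z) + y \<odot> (z \<odot> x)"
    and "square_zero x" "square_zero y" "x \<bottom> y" "x \<noteq> 0" "y \<notin> span {x}"
  shows "\<exists>\<epsilon>::'f. \<epsilon> * \<epsilon> - \<epsilon> + 1 = 0"
proof -
  have sq: "x \<odot> x = 0" "y \<odot> y = 0" and orth: "x \<odot> y = 0" "y \<odot> x = 0" and Bxy: "B x y = 0"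
    using assms(2-4) B_orthogonal by (auto simp: square_zero_def orthogonal_def)
  obtain b where b: "B b x = 0" "B b y = 1"
    using exists_dual2[OF assms(5,6)] by blast
  define e where "e = x \<odot> b"
  define f where "f = b \<odot> x"
  define p where "p = y \<odot> b"
  define q where "q = b \<odot> y"
  have "x \<odot> e = 0"
    using swap_right[of x x b] b sq by (simp add: e_def B_sym)
  then obtain \<epsilon> where \<epsilon>: "e \<odot> y = \<epsilon> *\<^sub>F x"
    using annihilated_mul[of x e y] assms(5) orth by blast
  have "f \<odot> x = 0"
    using swap_left[of b x x] b sq by (simp add: f_def)
  then obtain \<rho> where \<rho>: "y \<odot> f = \<rho> *\<^sub>F x"
    using annihilated_mul[of x y f] assms(5) orth by blast
  have px: "p \<odot> x = - (\<epsilon> *\<^sub>F x)"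
    using swap_left[of y b x] Bxy \<epsilon> by (simp add: p_def e_def B_sym)
  have xp: "x \<odot> p = 0"
    using swap_right[of x y b] b orth by (simp add: p_def B_sym)
  have fy: "f \<odot> y = x"
    using swap_left[of b x y] b orth by (simp add: f_def)
  have xq: "x \<odot> q = - (\<rho> *\<^sub>F x)"
    using swap_right[of x b y] Bxy \<rho> by (simp add: q_def f_def)
  have "p \<odot> x + f \<odot> y = y \<odot> f"
    using cyclic[of x y b] orth xp by (simp add: p_def f_def)
  then have "(1 - \<epsilon> - \<rho>) *\<^sub>F x = 0"
    using px fy \<rho> by (simp add: scale_left_diff_distrib)
  then have "\<rho> = 1 - \<epsilon>"
    using assms(5) by simp
  have "B y p = 0"
    using B_assoc[of y y b] sq by (simp add: p_def)
  have "((b \<odot> b) \<odot> y) \<odot> y = B (b \<odot> b) y *\<^sub>F y"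
    using swap_left[of "b \<odot> b" y y] sq by simp
  moreover have "p \<odot> b = b - (b \<odot> b) \<odot> y"
    using swap_left[of y b b] b by (simp add: p_def B_sym)
  ultimately have pp: "p \<odot> p = - q + B (b \<odot> b) y *\<^sub>F y"
    using swap_left[of y b p] \<open>B y p = 0\<close> by (simp add: mul_linear q_def flip: p_def)
  have "x \<odot> (p \<odot> p) = \<rho> *\<^sub>F x"
    by (simp add: pp mul_linear xq orth)
  moreover have "x \<odot> (p \<odot> p) = - (p \<odot> (p \<odot> x))"
    using swap_right[of x p p] B_assoc[of x y b] orth by (simp add: p_def)
  moreover have "p \<odot> (p \<odot> x) = (\<epsilon> * \<epsilon>) *\<^sub>F x"
    by (simp add: px mul_linear)
  ultimately have "(\<rho> + \<epsilon> * \<epsilon>) *\<^sub>F x = 0"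
    by (simp add: scale_left_distrib flip: \<open>x \<odot> (p \<odot> p) = \<rho> *\<^sub>F x\<close>)
  then have "\<rho> + \<epsilon> * \<epsilon> = 0"
    using assms(5) by simp
  then have "\<epsilon> * \<epsilon> - \<epsilon> + 1 = 0"
    by (simp add: \<open>\<rho> = 1 - \<epsilon>\<close> algebra_simps)
  then show ?thesis
    by blast
qed

section \<open>The cubic form, mainly in characteristic 3\<close>

definition cubic :: "'v \<Rightarrow> 'f" where
  "cubic v = B v (v \<odot> v)"

lemma cubic_scale: "cubic (c *\<^sub>F v) = c ^ 3 * cubic v"
  by (simp add: cubic_def mul_linear B_linear power3_eq_cube)

text \<open>By associativity and symmetry of \<open>B\<close>, the mixed terms of each degree
  coincide in threes.\<close>

lemma cubic_add:
  assumes "(3 :: 'f) = 0"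
  shows "cubic (u + v) = cubic u + cubic v"
proof -
  have 1: "B u (u \<odot> v) = B v (u \<odot> u)" "B u (v \<odot> u) = B v (u \<odot> u)"
    "B v (u \<odot> v) = B u (v \<odot> v)" "B v (v \<odot> u) = B u (v \<odot> v)"
    by (metis B_assoc B_sym)+
  have "cubic (u + v) = cubic u + cubic v + 3 * B v (u \<odot> u) + 3 * B u (v \<odot> v)"
    by (simp add: cubic_def mul_linear B_linear 1)
  then show ?thesis
    by (simp add: assms)
qed

text \<open>The square of \<open>x \<odot> v\<close> is a combination of x and
  \<open>v \<odot> x\<close>. Since x is \<open>B\<close>-orthogonal to its own products, pairing
  with \<open>x \<odot> v\<close> leaves only \<open>B (x \<odot> v) (v \<odot> x)\<close>, which is
  the square of \<open>B x v\<close>.\<close>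

lemma cubic_mul_square_zero:
  assumes "square_zero x"
  shows "cubic (x \<odot> v) = (- B x v) ^ 3" "cubic (v \<odot> x) = (- B x v) ^ 3"
proof -
  have sq: "x \<odot> x = 0"
    using assms by (simp add: square_zero_def)
  have B0: "B x (x \<odot> v) = 0" "B x (v \<odot> x) = 0" "B x (x \<odot> u) = 0" for u
    using B_assoc[of x x] B_assoc[of v x x] sq by (simp_all add: B_sym)
  have "v \<odot> (v \<odot> x) = B x v *\<^sub>F v - x \<odot> (v \<odot> v)"
    using swap_right[of v v x] by (simp add: B_sym)
  then have mixed: "B (x \<odot> v) (v \<odot> x) = B x v * B x v"
    by (simp add: B_assoc B_linear B0)
  have "((v \<odot> v) \<odot> x) \<odot> x = B x (v \<odot> v) *\<^sub>F x"
    using swap_left[of "v \<odot> v" x x] sq by (simp add: B_sym)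
  moreover have "(x \<odot> v) \<odot> v = B x v *\<^sub>F v - (v \<odot> v) \<odot> x"
    by (rule swap_left)
  ultimately have "(x \<odot> v) \<odot> (x \<odot> v) = B x (v \<odot> v) *\<^sub>F x - B x v *\<^sub>F (v \<odot> x)"
    using swap_left[of x v "x \<odot> v"] B0 by (simp add: mul_linear)
  then show "cubic (x \<odot> v) = (- B x v) ^ 3"
    using B0(1) mixed by (simp add: cubic_def B_linear B_sym power3_eq_cube)
  have "x \<odot> (x \<odot> (v \<odot> v)) = B x (v \<odot> v) *\<^sub>F x"
    using swap_right[of x x "v \<odot> v"] sq by simp
  moreover have "v \<odot> (v \<odot> x) = B x v *\<^sub>F v - x \<odot> (v \<odot> v)"
    by fact
  ultimately have "(v \<odot> x) \<odot> (v \<odot> x) = B x (v \<odot> v) *\<^sub>F x - B x v *\<^sub>F (x \<odot> v)"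
    using swap_right[of "v \<odot> x" v x] B0 by (simp add: mul_linear B_sym)
  then show "cubic (v \<odot> x) = (- B x v) ^ 3"
    using B0(2) mixed by (simp add: cubic_def B_linear B_sym power3_eq_cube)
qed

text \<open>
  The vectors with cubic value in \<open>F\<^sup>3\<close> form a subspace containing all products with \<open>x\<close>, \<open>y\<close>,
  \<open>z\<close>. Anything \<open>B\<close>-orthogonal to these products annihilates \<open>x\<close>, \<open>y\<close>, \<open>z\<close>, hence lies in
  \<open>F x\<close>; so the subspace contains the hyperplane \<open>B\<close>-orthogonal to \<open>x\<close>.
\<close>

lemma cubic_range:
  assumes three: "(3 :: 'f) = 0"
    and xyz: "square_zero x" "square_zero y" "square_zero z" "x \<bottom> y" "x \<bottom> z"
      "x \<noteq> 0" "y \<notin> span {x}" "z \<notin> span {x, y}"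
  shows "\<exists>\<delta>. \<forall>v. \<exists>s t. cubic v = s ^ 3 * \<delta> + t ^ 3"
proof -
  define K where "K = {v. \<exists>t. cubic v = t ^ 3}"
  \<comment> \<open>In characteristic 3 both \<open>cubic\<close> and the cube map of the field are
    additive.\<close>
  have K: "subspace K"
  proof (rule subspaceI)
    show "0 \<in> K"
      by (auto simp: K_def cubic_def intro: exI[of _ 0])
    show "u + v \<in> K" if "u \<in> K" "v \<in> K" for u v
      using that by (auto simp: K_def cubic_add[OF three] simp flip: cube_add_char3[OF three])
    show "c *\<^sub>F v \<in> K" if "v \<in> K" for c v
      using that by (auto simp: K_def cubic_scale simp flip: power_mult_distrib)
  qed
  have mul_K: "u \<odot> v \<in> K" "v \<odot> u \<in> K" if "square_zero u" for u v
    unfolding K_def using cubic_mul_square_zero[OF that, of v] by blast+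
  have perp_orth: "u \<bottom> w" if u: "square_zero u" and w: "\<And>k. k \<in> K \<Longrightarrow> B w k = 0" for u w
  proof (rule ccontr)
    assume "\<not> u \<bottom> w"
    then consider "u \<odot> w \<noteq> 0" | "w \<odot> u \<noteq> 0"
      by (auto simp: orthogonal_def)
    then show False
    proof cases
      case 1
      then obtain v where "B v (u \<odot> w) = 1"
        using exists_dual1 by blast
      then show False
        using w[OF mul_K(2)[OF u, of v]] B_assoc[of v u w] by (simp add: B_sym)
    next
      case 2
      then obtain v where "B v (w \<odot> u) = 1"
        using exists_dual1 by blast
      then show False
        using w[OF mul_K(1)[OF u, of v]] B_assoc[of w u v] by (simp add: B_sym)
    qed
  qed
  have perp: "w \<in> span {x}" if w: "\<And>k. k \<in> K \<Longrightarrow> B w k = 0" for w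
  proof (rule ccontr)
    assume nw: "w \<notin> span {x}"
    have o: "x \<bottom> w" "y \<bottom> w" "z \<bottom> w"
      using perp_orth w xyz by blast+
    obtain a b where w_eq: "w = a *\<^sub>F x + b *\<^sub>F y"
      using orthogonal_triple[OF xyz(1,2,4) o(1,2) xyz(6,7)] by (auto simp: span_pair)
    \<comment> \<open>As z is orthogonal to w and to x, a nonzero y-coefficient of w makes z
      orthogonal to y, against \<open>orthogonal_triple\<close>.\<close>
    have "b \<noteq> 0"
      using nw w_eq by (auto simp: span_singleton)
    moreover have "b *\<^sub>F (y \<odot> z) = 0" "b *\<^sub>F (z \<odot> y) = 0"
      using o(3) xyz(5) by (simp_all add: orthogonal_def w_eq mul_linear)
    ultimately have "y \<bottom> z"
      by (simp add: orthogonal_def)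
    then show False
      using orthogonal_triple[OF xyz(1,2,4,5) _ xyz(6,7)] xyz(8) by blast
  qed
  \<comment> \<open>The constant \<delta> will be \<open>cubic c\<close>: subtracting
    \<open>B v x\<close> times c moves v into the hyperplane orthogonal to x.\<close>
  obtain c where c: "B c x = 1"
    using exists_dual1 xyz by blast
  have "v \<in> K" if v: "B v x = 0" for v
  proof (rule ccontr)
    assume "v \<notin> K"
    then obtain w where w: "\<And>k. k \<in> K \<Longrightarrow> B w k = 0" "B w v = 1"
      using exists_dual_subspace[OF K] by blast
    then obtain r where "w = r *\<^sub>F x"
      using perp[of w] by (auto simp: span_singleton)
    with v w show False
      by (simp add: B_linear B_sym)
  qed
  then have "v - B v x *\<^sub>F c \<in> K" for v
    by (simp add: B_linear c)
  then have "\<exists>t. cubic (v - B v x *\<^sub>F c) = t ^ 3" for v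
    by (simp add: K_def)
  moreover have "cubic v = cubic (v - B v x *\<^sub>F c) + (B v x) ^ 3 * cubic c" for v
    using cubic_add[OF three, of "v - B v x *\<^sub>F c" "B v x *\<^sub>F c"] by (simp add: cubic_scale)
  ultimately show ?thesis
    by (metis add.commute)
qed

end

section \<open>The algebras with parameters \<open>\<alpha>\<close>, \<open>\<beta>\<close>\<close>

text \<open>With indices read modulo 3, the norm pairs \<open>z_{i,j}\<close> with
  \<open>z_{-i,-j}\<close>: four hyperbolic planes.\<close>

definition okubo_norm :: "'f::field \<Rightarrow> 'f \<Rightarrow> 'f ^ okubo_index \<Rightarrow> 'f" where
  "okubo_norm \<alpha> \<beta> x = \<alpha> * x $ Z10 * x $ Z20 + \<beta> * x $ Z01 * x $ Z02
     + \<alpha> * \<beta> * x $ Z11 * x $ Z22 + \<alpha> * \<beta> * x $ Z12 * x $ Z21"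

definition okubo_polar :: "'f::field \<Rightarrow> 'f \<Rightarrow> 'f ^ okubo_index \<Rightarrow> 'f ^ okubo_index \<Rightarrow> 'f" where
  "okubo_polar \<alpha> \<beta> x y = okubo_norm \<alpha> \<beta> (x + y) - okubo_norm \<alpha> \<beta> x - okubo_norm \<alpha> \<beta> y"

lemma UNIV_okubo_index: "UNIV = {Z10, Z20, Z01, Z02, Z11, Z22, Z12, Z21}"
  using okubo_index.exhaust by blast

lemma sum_okubo_index:
  "sum h (UNIV :: okubo_index set) =
     h Z10 + h Z20 + h Z01 + h Z02 + h Z11 + h Z22 + h Z12 + h Z21"
  by (simp add: UNIV_okubo_index add.assoc)

lemma all_okubo_index:
  "(\<forall>i. P i) \<longleftrightarrow> P Z10 \<and> P Z20 \<and> P Z01 \<and> P Z02 \<and> P Z11 \<and> P Z22 \<and> P Z12 \<and> P Z21"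
  by (metis okubo_index.exhaust)

lemma okubo_mult_nth:
  "okubo_mult \<alpha> \<beta> x y $ Z10 = \<alpha> * x $ Z20 * y $ Z20 - \<beta> * x $ Z02 * y $ Z11 - \<alpha> * \<beta> * x $ Z22 * y $ Z21 - \<beta> * x $ Z12 * y $ Z01"
  "okubo_mult \<alpha> \<beta> x y $ Z20 = x $ Z10 * y $ Z10 - \<beta> * x $ Z01 * y $ Z22 - \<beta> * x $ Z11 * y $ Z12 - \<beta> * x $ Z21 * y $ Z02"
  "okubo_mult \<alpha> \<beta> x y $ Z01 = \<beta> * x $ Z02 * y $ Z02 - \<alpha> * x $ Z10 * y $ Z21 - \<alpha> * x $ Z11 * y $ Z20 - \<alpha> * \<beta> * x $ Z12 * y $ Z22"
  "okubo_mult \<alpha> \<beta> x y $ Z02 = x $ Z01 * y $ Z01 - \<alpha> * x $ Z20 * y $ Z12 - \<alpha> * x $ Z22 * y $ Z10 - \<alpha> * x $ Z21 * y $ Z11"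
  "okubo_mult \<alpha> \<beta> x y $ Z11 = \<alpha> * \<beta> * x $ Z22 * y $ Z22 - x $ Z10 * y $ Z01 - \<beta> * x $ Z02 * y $ Z12 - \<alpha> * x $ Z21 * y $ Z20"
  "okubo_mult \<alpha> \<beta> x y $ Z22 = x $ Z11 * y $ Z11 - x $ Z20 * y $ Z02 - x $ Z01 * y $ Z21 - x $ Z12 * y $ Z10"
  "okubo_mult \<alpha> \<beta> x y $ Z12 = \<alpha> * x $ Z21 * y $ Z21 - \<alpha> * x $ Z20 * y $ Z22 - x $ Z02 * y $ Z10 - x $ Z11 * y $ Z01"
  "okubo_mult \<alpha> \<beta> x y $ Z21 = \<beta> * x $ Z12 * y $ Z12 - x $ Z10 * y $ Z11 - x $ Z01 * y $ Z20 - \<beta> * x $ Z22 * y $ Z02"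
  unfolding okubo_mult_def by (simp_all add: sum_okubo_index axis_def mult_ac)

lemma okubo_mult_flexible_left:
  "okubo_mult \<alpha> \<beta> (okubo_mult \<alpha> \<beta> x y) x = okubo_norm \<alpha> \<beta> x *s y"
  unfolding vec_eq_iff all_okubo_index
  by (simp add: okubo_mult_nth okubo_norm_def; intro conjI; algebra)

lemma okubo_mult_flexible_right:
  "okubo_mult \<alpha> \<beta> x (okubo_mult \<alpha> \<beta> y x) = okubo_norm \<alpha> \<beta> x *s y"
  unfolding vec_eq_iff all_okubo_index
  by (simp add: okubo_mult_nth okubo_norm_def; intro conjI; algebra)

lemma okubo_polar_assoc:
  "okubo_polar \<alpha> \<beta> (okubo_mult \<alpha> \<beta> x y) z = okubo_polar \<alpha> \<beta> x (okubo_mult \<alpha> \<beta> y z)"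
  unfolding okubo_polar_def okubo_norm_def by (simp add: okubo_mult_nth) algebra

text \<open>
  This identity fails in para-octonion algebras, although these satisfy every assumption of
  \<open>symmetric_composition_algebra\<close>; it is what rules out a planar
  square-zero subalgebra without a root of \<open>\<epsilon>\<^sup>2 - \<epsilon> + 1\<close>.
\<close>

lemma okubo_mult_cyclic:
  fixes \<alpha> \<beta> :: "'f::field"
  defines "m \<equiv> okubo_mult \<alpha> \<beta>"
  shows "m (m x y) z + m (m y z) x + m (m z x) y = m z (m x y) + m x (m y z) + m y (m z x)"
  unfolding vec_eq_iff all_okubo_index m_def
  by (simp add: okubo_mult_nth; intro conjI; algebra)

lemma okubo_polar_eq:
  "okubo_polar \<alpha> \<beta> x y = \<alpha> * (x $ Z10 * y $ Z20 + x $ Z20 * y $ Z10)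
     + \<beta> * (x $ Z01 * y $ Z02 + x $ Z02 * y $ Z01)
     + \<alpha> * \<beta> * (x $ Z11 * y $ Z22 + x $ Z22 * y $ Z11 + x $ Z12 * y $ Z21 + x $ Z21 * y $ Z12)"
  by (simp add: okubo_polar_def okubo_norm_def algebra_simps)

lemma okubo_polar_representable:
  fixes l :: "'f::field ^ okubo_index \<Rightarrow> 'f"
  assumes "\<alpha> \<noteq> 0" "\<beta> \<noteq> 0" "Vector_Spaces.linear (*s) (*) l"
  shows "\<exists>w. \<forall>v. okubo_polar \<alpha> \<beta> w v = l v"
proof -
  interpret l: Vector_Spaces.linear "(*s)" "(*)" l
    by fact
  \<comment> \<open>The polar form pairs each basis vector only with its opposite, so each
    coordinate of w is the value of l at the opposite basis vector divided by the coefficient of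
    that pair.\<close>
  define w :: "'f ^ okubo_index" where "w = (\<chi> i. case i of
      Z10 \<Rightarrow> l (axis Z20 1) / \<alpha> | Z20 \<Rightarrow> l (axis Z10 1) / \<alpha>
    | Z01 \<Rightarrow> l (axis Z02 1) / \<beta> | Z02 \<Rightarrow> l (axis Z01 1) / \<beta>
    | Z11 \<Rightarrow> l (axis Z22 1) / (\<alpha> * \<beta>) | Z22 \<Rightarrow> l (axis Z11 1) / (\<alpha> * \<beta>)
    | Z12 \<Rightarrow> l (axis Z21 1) / (\<alpha> * \<beta>) | Z21 \<Rightarrow> l (axis Z12 1) / (\<alpha> * \<beta>))"
  have "okubo_polar \<alpha> \<beta> w v = l v" for v
  proof -
    have "l v = l (\<Sum>i\<in>UNIV. v $ i *s axis i 1)"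
      by (simp add: basis_expansion)
    also have "\<dots> = (\<Sum>i\<in>UNIV. v $ i * l (axis i 1))"
      by (simp add: l.sum l.scale)
    also have "\<dots> = okubo_polar \<alpha> \<beta> w v"
      using assms(1,2) by (simp add: okubo_polar_eq sum_okubo_index w_def field_simps)
    finally show ?thesis ..
  qed
  then show ?thesis
    by blast
qed

lemma symmetric_composition_algebra_pullback:
  assumes "nonassoc_algebra scl mul" "Vector_Spaces.linear scl (*s) f" "bij f"
    and f_mul: "\<And>a b. f (mul a b) = okubo_mult \<alpha> \<beta> (f a) (f b)"
    and "\<alpha> \<noteq> 0" "\<beta> \<noteq> 0"
  shows "symmetric_composition_algebra scl mul (\<lambda>x. okubo_norm \<alpha> \<beta> (f x))
    (\<lambda>x y. okubo_polar \<alpha> \<beta> (f x) (f y))"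
proof -
  interpret nonassoc_algebra scl mul
    by fact
  interpret f: Vector_Spaces.linear scl "(*s)" f
    by fact
  have inj: "a = b" if "f a = f b" for a b
    using that assms(3) by (simp add: bij_is_inj inj_eq)
  show ?thesis
  proof
    show "mul (mul x y) x = scl (okubo_norm \<alpha> \<beta> (f x)) y"
      "mul x (mul y x) = scl (okubo_norm \<alpha> \<beta> (f x)) y" for x y
      by (rule inj; simp add: f_mul f.scale okubo_mult_flexible_left okubo_mult_flexible_right)+
    show "okubo_polar \<alpha> \<beta> (f x) (f y) = okubo_norm \<alpha> \<beta> (f (x + y)) - okubo_norm \<alpha> \<beta> (f x)
      - okubo_norm \<alpha> \<beta> (f y)" for x y
      by (simp add: okubo_polar_def f.add)
    show "okubo_polar \<alpha> \<beta> (f (x + y)) (f z) = okubo_polar \<alpha> \<beta> (f x) (f z) + okubo_polar \<alpha> \<beta> (f y) (f z)"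
      for x y z
      by (simp add: okubo_polar_eq f.add algebra_simps)
    show "okubo_polar \<alpha> \<beta> (f (scl c x)) (f y) = c * okubo_polar \<alpha> \<beta> (f x) (f y)" for c x y
      by (simp add: okubo_polar_eq f.scale algebra_simps)
    show "okubo_polar \<alpha> \<beta> (f (mul x y)) (f z) = okubo_polar \<alpha> \<beta> (f x) (f (mul y z))" for x y z
      by (simp add: f_mul okubo_polar_assoc)
    show "\<exists>w. \<forall>v. okubo_polar \<alpha> \<beta> (f w) (f v) = l v" if l: "Vector_Spaces.linear scl (*) l" for l
    proof -
      interpret l: Vector_Spaces.linear scl "(*)" l
        by fact
      have f_inv: "f (inv f v) = v" for v
        using assms(3) by (simp add: bij_is_surj surj_f_inv_f)
      have "Vector_Spaces.linear (*s) (*) (\<lambda>v. l (inv f v))"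
        unfolding Vector_Spaces.linear_iff
      proof (intro conjI allI)
        have "inv f (u + v) = inv f u + inv f v" for u v
          by (rule inj) (simp add: f_inv f.add)
        then show "l (inv f (u + v)) = l (inv f u) + l (inv f v)" for u v
          by (simp add: l.add)
        have "inv f (c *s v) = scl c (inv f v)" for c v
          by (rule inj) (simp add: f_inv f.scale)
        then show "l (inv f (c *s v)) = c * l (inv f v)" for c v
          by (simp add: l.scale)
      qed (fact vec.vector_space_axioms vector_space_over_itself.vector_space_axioms)+
      then obtain w where w: "\<And>v. okubo_polar \<alpha> \<beta> w v = l (inv f v)"
        using okubo_polar_representable[OF assms(5,6)] by blast
      have "okubo_polar \<alpha> \<beta> (f (inv f w)) (f v) = l v" for v
        using w[of "f v"] assms(3) by (simp add: f_inv bij_is_inj)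
      then show ?thesis
        by blast
    qed
  qed
qed

text \<open>The table is graded by pairs of residues modulo 3, with \<alpha> and \<beta> recording
  wrap-around of the indices. Scaling \<open>z_{i,j}\<close> by \<open>a^i b^j\<close> therefore
  absorbs the parameters \<open>a^3\<close> and \<open>b^3\<close>.\<close>

definition okubo_rescale :: "'f::field \<Rightarrow> 'f \<Rightarrow> 'f ^ okubo_index \<Rightarrow> 'f ^ okubo_index" where
  "okubo_rescale a b x = (\<chi> i. (case i of Z10 \<Rightarrow> a | Z20 \<Rightarrow> a * a | Z01 \<Rightarrow> b | Z02 \<Rightarrow> b * b
     | Z11 \<Rightarrow> a * b | Z22 \<Rightarrow> a * a * b * b | Z12 \<Rightarrow> a * b * b | Z21 \<Rightarrow> a * a * b) * x $ i)"

lemma okubo_rescale_mult: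
  "okubo_rescale a b (okubo_mult (a ^ 3) (b ^ 3) x y)
     = okubo_mult 1 1 (okubo_rescale a b x) (okubo_rescale a b y)"
  unfolding vec_eq_iff all_okubo_index okubo_rescale_def
  by (simp add: okubo_mult_nth power3_eq_cube; intro conjI; algebra)

lemma okubo_rescale_linear: "Vector_Spaces.linear (*s) (*s) (okubo_rescale a b)"
  unfolding Vector_Spaces.linear_iff
  by (auto simp: okubo_rescale_def vec_eq_iff algebra_simps intro: vec.vector_space_axioms)

lemma okubo_rescale_bij:
  assumes "a \<noteq> 0" "b \<noteq> 0"
  shows "bij (okubo_rescale a b)"
proof (rule bij_betw_byWitness[where f' = "okubo_rescale (1 / a) (1 / b)"])
  show "\<forall>x\<in>UNIV. okubo_rescale (1 / a) (1 / b) (okubo_rescale a b x) = x"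
    "\<forall>x\<in>UNIV. okubo_rescale a b (okubo_rescale (1 / a) (1 / b) x) = x"
    using assms by (simp_all add: okubo_rescale_def vec_eq_iff all_okubo_index)
qed auto

text \<open>Eliminating \<delta> gives c a quadratic equation over the subfield of cubes. But c is
  also a root of the purely inseparable polynomial \<open>X^3 - c^3\<close>, so it already lies in
  that subfield.\<close>

lemma cube_of_cube_combinations:
  fixes c :: "'f::field"
  assumes three: "(3 :: 'f) = 0"
    and c: "c = s ^ 3 * \<delta> + t ^ 3" and cc: "c * c = s' ^ 3 * \<delta> + t' ^ 3"
  shows "\<exists>a. c = a ^ 3"
proof (cases "s = 0")
  case True
  with c show ?thesis
    by auto
next
  case False
  note cube_add = cube_add_char3[OF three]
  have cube_diff: "(u - v) ^ 3 = u ^ 3 - v ^ 3" for u v :: 'f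
    using cube_add[of u "- v"] by simp
  define r where "r = s' / s"
  define q where "q = t' - r * t"
  have "s' = r * s"
    using False by (simp add: r_def)
  then have "c * c = r ^ 3 * (s ^ 3 * \<delta>) + t' ^ 3"
    by (simp add: cc power_mult_distrib)
  also have "s ^ 3 * \<delta> = c - t ^ 3"
    using c by simp
  finally have cc': "c * c = r ^ 3 * c + q ^ 3"
    by (simp add: q_def cube_diff power_mult_distrib algebra_simps)
  have "c ^ 3 = c * c * c"
    by (rule power3_eq_cube)
  also have "\<dots> = (r ^ 3 * c + q ^ 3) * c"
    by (simp only: cc')
  also have "\<dots> = r ^ 3 * (c * c) + q ^ 3 * c"
    by (simp add: algebra_simps)
  also have "\<dots> = (r ^ 6 + q ^ 3) * c + r ^ 3 * q ^ 3"
    unfolding cc' by (simp add: algebra_simps flip: power_add)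
  \<comment> \<open>If r * r + q is nonzero, dividing by its cube exhibits c as a cube. If it
    vanishes, the quadratic is the square of c + r ^ 3, because -1 = 2.\<close>
  finally have "(r * r + q) ^ 3 * c = (c - r * q) ^ 3"
    by (simp add: cube_add cube_diff power_mult_distrib flip: power_add)
  moreover have "\<exists>a. c = a ^ 3" if "r * r + q = 0"
  proof -
    have "q = - (r * r)"
      using that by (simp add: eq_neg_iff_add_eq_0 add.commute)
    then have "(c + r ^ 3) * (c + r ^ 3) = 3 * (r ^ 3 * c)"
      using cc' by (simp add: algebra_simps)
    then have "c = (- r) ^ 3"
      by (simp add: three eq_neg_iff_add_eq_0)
    then show ?thesis ..
  qed
  moreover have "c = ((c - r * q) / (r * r + q)) ^ 3" if "r * r + q \<noteq> 0"
    using that calculation(1) by (simp add: power_divide field_simps)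
  ultimately show ?thesis
    by blast
qed

text \<open>The quadratic divides \<open>X^3 + 1\<close>, and its value at -1 is 3, which is nonzero
  here.\<close>

lemma primitive_cube_root_from_quadratic:
  fixes \<epsilon> :: "'f::field"
  assumes "CHAR('f) \<noteq> 3" and \<epsilon>: "\<epsilon> * \<epsilon> - \<epsilon> + 1 = 0"
  shows "primitive_root_of_unity 3 (- \<epsilon>)"
proof -
  have three: "(3 :: 'f) \<noteq> 0"
  proof
    assume "(3 :: 'f) = 0"
    then have "of_nat 3 = (0 :: 'f)"
      by simp
    then have dvd: "CHAR('f) dvd 3"
      by (simp only: of_nat_eq_0_iff_char_dvd)
    then have "CHAR('f) \<le> 3"
      by (rule dvd_imp_le) simp
    then consider "CHAR('f) = 0" | "CHAR('f) = 1" | "CHAR('f) = 2" | "CHAR('f) = 3"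
      by linarith
    then show False
      using assms(1) dvd by cases auto
  qed
  have cube: "(- \<epsilon>) ^ 3 = 1"
    using \<epsilon> by (simp add: power3_eq_cube) algebra
  have "- \<epsilon> \<noteq> 1"
  proof
    assume "- \<epsilon> = 1"
    then have "\<epsilon> = - 1"
      by (metis minus_minus)
    with \<epsilon> three show False
      by simp
  qed
  moreover have "(- \<epsilon>) ^ 2 \<noteq> 1"
  proof
    assume "(- \<epsilon>) ^ 2 = 1"
    with cube have "- \<epsilon> = 1"
      by (simp add: power3_eq_cube power2_eq_square)
    with calculation show False ..
  qed
  moreover have "m = 1 \<or> m = 2" if "0 < m \<and> m < 3" for m :: nat
    using that by auto
  ultimately have "(- \<epsilon>) ^ m \<noteq> 1" if "0 < m \<and> m < 3" for m
    using that power_one_right by metis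
  with cube show ?thesis
    by (simp add: primitive_root_of_unity_def)
qed

section \<open>Uniqueness of shortest walks\<close>

lemma (in wf_digraph) \<mu>_unit_cost_attained:
  assumes "\<mu> (\<lambda>_. 1) u v = ereal (real k)"
  shows "\<exists>p. awalk u p v \<and> length p = k" and "awalk u p v \<Longrightarrow> k \<le> length p"
proof -
  have cost: "awalk_cost (\<lambda>_. 1) p = real (length p)" for p :: "'b list"
    by (induction p) simp_all
  have lower: "k \<le> length p" if "awalk u p v" for p
    using min_cost_le_walk_cost[OF that, of "\<lambda>_. 1"] assms by (simp add: cost)
  then show "awalk u p v \<Longrightarrow> k \<le> length p" .
  \<comment> \<open>An infimum over no walks would be infinite. Since lengths are natural numbers,
    the infimum over existing walks is a minimum.\<close>
  have "u \<rightarrow>\<^sup>* v"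
    using shortest_path_inf[of u v "\<lambda>_. 1"] assms by auto
  then obtain p0 where "awalk u p0 v"
    by (auto simp: reachable_awalk)
  then obtain q where q: "awalk u q v" "\<And>r. awalk u r v \<Longrightarrow> length q \<le> length r"
    using ex_has_least_nat[of "\<lambda>p. awalk u p v" p0 length] by blast
  have "ereal (real (length q)) \<le> \<mu> (\<lambda>_. 1) u v"
    unfolding \<mu>_def using q(2) by (auto intro!: INF_greatest simp: cost)
  with assms lower[OF q(1)] have "length q = k"
    by simp
  with q(1) show "\<exists>p. awalk u p v \<and> length p = k"
    by blast
qed

text \<open>A repeated vertex bounds a closed segment that could be cut out.\<close>

lemma (in wf_digraph) shortest_awalk_apath:
  assumes "awalk u p v" and "\<And>q. awalk u q v \<Longrightarrow> length p \<le> length q"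
  shows "apath u p v"
proof -
  have "distinct (awalk_verts u p)"
  proof (rule ccontr)
    assume "\<not> distinct (awalk_verts u p)"
    then obtain q r s w where p: "p = q @ r @ s" "0 < length r" and "awalk u q w" "awalk w s v"
      using awalk_not_distinct_decomp[OF assms(1)] by blast
    then have "awalk u (q @ s) v"
      by (intro awalk_appendI)
    from assms(2)[OF this] p show False
      by simp
  qed
  with assms(1) show ?thesis
    by (simp add: apath_def)
qed

text \<open>
  Vertices outside \<open>C\<close> have at most one neighbour, and adjacency is transitive on \<open>C\<close>.  Hence a
  shortest walk has its interior in \<open>C\<close>, and no three consecutive vertices of it lie in \<open>C\<close>.
\<close>

locale clique_core_digraph = pair_wf_digraph +
  fixes C :: "'a set"
  assumes sym: "(u, v) \<in> parcs G \<Longrightarrow> (v, u) \<in> parcs G"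
    and outside: "u \<notin> C \<Longrightarrow> (u, v) \<in> parcs G \<Longrightarrow> (u, w) \<in> parcs G \<Longrightarrow> v = w"
    and inside: "(u, v) \<in> parcs G \<Longrightarrow> (v, w) \<in> parcs G \<Longrightarrow> u \<in> C \<Longrightarrow> v \<in> C \<Longrightarrow> w \<in> C \<Longrightarrow>
      u \<noteq> w \<Longrightarrow> (u, w) \<in> parcs G"
begin

text \<open>If the second or third vertex were an inner vertex outside \<open>C\<close>, its only
  neighbour would force the walk to turn back. Hence the first three vertices lie in
  \<open>C\<close>, and the chord from the first to the third shortens the walk.\<close>

lemma shortest_awalk_in_core:
  assumes "awalk u p v" "\<And>q. awalk u q v \<Longrightarrow> length p \<le> length q" "u \<in> C" "v \<in> C"
  shows "p = [] \<or> p = [(u, v)]"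
proof (cases p)
  case (Cons a p1)
  then obtain w where a: "a = (u, w)" and uw: "(u, w) \<in> parcs G" and p1: "awalk w p1 v"
    using assms(1) by (cases a) (auto simp: awalk_Cons_iff)
  show ?thesis
  proof (cases p1)
    case Nil
    with p1 a Cons show ?thesis
      by (auto simp: awalk_Nil_iff)
  next
    case (Cons b p2)
    then obtain w2 where b: "b = (w, w2)" and ww2: "(w, w2) \<in> parcs G" and p2: "awalk w2 p2 v"
      using p1 by (cases b) (auto simp: awalk_Cons_iff)
    have p: "length p = Suc (Suc (length p2))"
      using \<open>p = a # p1\<close> Cons by simp
    have "u \<noteq> w2"
      using assms(2)[of p2] p2 p by (metis Suc_n_not_le_n le_SucI)
    then have "w \<in> C"
      using outside[OF _ sym[OF uw] ww2] by blast
    have "w2 \<in> C"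
    proof (cases p2)
      case Nil
      with p2 assms(4) show ?thesis
        by (auto simp: awalk_Nil_iff)
    next
      case (Cons c p3)
      then obtain w3 where ww3: "(w2, w3) \<in> parcs G" and p3: "awalk w3 p3 v"
        using p2 Cons by (cases c) (auto simp: awalk_Cons_iff)
      show ?thesis
      proof (rule ccontr)
        assume "w2 \<notin> C"
        then have "w3 = w"
          using outside[OF _ ww3 sym[OF ww2]] by simp
        then have "awalk u ((u, w) # p3) v"
          using p3 uw by (simp add: awalk_Cons_iff)
        from assms(2)[OF this] p Cons show False
          by simp
      qed
    qed
    then have "(u, w2) \<in> parcs G"
      using inside[OF uw ww2 assms(3) \<open>w \<in> C\<close> _ \<open>u \<noteq> w2\<close>] by simp
    then have "awalk u ((u, w2) # p2) v"
      using p2 by (simp add: awalk_Cons_iff)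
    from assms(2)[OF this] p show ?thesis
      by simp
  qed
qed simp

text \<open>Induction on the length: an end outside \<open>C\<close> has only one possible arc, so
  both walks share it and it can be stripped off. If both ends lie in \<open>C\<close>, the walks
  have at most one arc.\<close>

lemma shortest_awalk_unique:
  assumes "awalk u p v" "awalk u q v" "length p = k" "length q = k"
    and "\<And>r. awalk u r v \<Longrightarrow> k \<le> length r"
  shows "p = q"
  using assms
proof (induction k arbitrary: u v p q)
  case 0
  show ?case
    using 0(3,4) by simp
next
  case (Suc k)
  consider "u \<notin> C" | "v \<notin> C" | "u \<in> C" "v \<in> C"
    by blast
  then show ?case
  proof cases
    case 1
    obtain a p1 where p: "p = a # p1" "length p1 = k"
      using Suc.prems(3) by (cases p) auto
    obtain b q1 where q: "q = b # q1" "length q1 = k"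
      using Suc.prems(4) by (cases q) auto
    obtain w where w: "a = (u, w)" "(u, w) \<in> parcs G" "awalk w p1 v"
      using Suc.prems(1) unfolding p by (cases a) (simp add: awalk_Cons_iff)
    obtain w' where w': "b = (u, w')" "(u, w') \<in> parcs G" "awalk w' q1 v"
      using Suc.prems(2) unfolding q by (cases b) (simp add: awalk_Cons_iff)
    have "w' = w"
      using outside[OF 1 w'(2) w(2)] .
    have "k \<le> length r" if "awalk w r v" for r
    proof -
      have "awalk u ((u, w) # r) v"
        using that w(2) by (simp add: awalk_Cons_iff)
      from Suc.prems(5)[OF this] show ?thesis
        by simp
    qed
    moreover have "awalk w q1 v"
      using w'(3) unfolding \<open>w' = w\<close> .
    ultimately have "p1 = q1"
      using Suc.IH[of w p1 v q1] w(3) p(2) q(2) by blast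
    then show ?thesis
      unfolding p q w(1) w'(1) \<open>w' = w\<close> by simp
  next
    case 2
    obtain p1 a where p: "p = p1 @ [a]" "length p1 = k"
      using Suc.prems(3) by (cases p rule: rev_cases) auto
    obtain q1 b where q: "q = q1 @ [b]" "length q1 = k"
      using Suc.prems(4) by (cases q rule: rev_cases) auto
    have last: "\<exists>w. c = (w, v) \<and> (w, v) \<in> parcs G \<and> awalk u r w" if "awalk u (r @ [c]) v" for r c
      using that unfolding awalk_append_iff by (cases c) (auto simp: awalk_simps)
    obtain w where w: "a = (w, v)" "(w, v) \<in> parcs G" "awalk u p1 w"
      using last Suc.prems(1) unfolding p by blast
    obtain w' where w': "b = (w', v)" "(w', v) \<in> parcs G" "awalk u q1 w'"
      using last Suc.prems(2) unfolding q by blast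
    have "w' = w"
      using outside[OF 2 sym[OF w'(2)] sym[OF w(2)]] .
    have "k \<le> length r" if "awalk u r w" for r
    proof -
      have "awalk w [(w, v)] v"
        using w(2) in_arcsD2[OF w(2)] by (simp add: awalk_simps)
      from Suc.prems(5)[OF awalk_appendI[OF that this]] show ?thesis
        by simp
    qed
    moreover have "awalk u q1 w"
      using w'(3) unfolding \<open>w' = w\<close> .
    ultimately have "p1 = q1"
      using Suc.IH[of u p1 w q1] w(3) p(2) q(2) by blast
    then show ?thesis
      unfolding p q w(1) w'(1) \<open>w' = w\<close> by simp
  next
    case 3
    have "r = [] \<or> r = [(u, v)]" if "awalk u r v" "length r = Suc k" for r
      using shortest_awalk_in_core[OF that(1) _ 3] Suc.prems(5) unfolding that(2) by blast
    then have "p = [] \<or> p = [(u, v)]" "q = [] \<or> q = [(u, v)]"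
      using Suc.prems(1-4) by blast+
    then show ?thesis
      using Suc.prems(3,4) by (elim disjE) simp_all
  qed
qed

lemma unique_shortest_path:
  assumes "graph_distance G u v = ereal (real k)"
  shows "\<exists>!p. path_of_length G k u p v"
proof -
  note attained = \<mu>_unit_cost_attained[OF assms[unfolded graph_distance_def]]
  obtain p where p: "awalk u p v" "length p = k"
    using attained(1) by blast
  show ?thesis
    unfolding path_of_length_def
  proof (rule ex1I[of _ p])
    show "apath u p v \<and> length p = k"
      using shortest_awalk_apath p attained(2) by blast
    show "q = p" if "apath u q v \<and> length q = k" for q
      using shortest_awalk_unique[of u q v p k] p attained(2) that by (simp add: apath_def)
  qed
qed

end

section \<open>The orthogonality graph\<close>

lemma line_scale:
  assumes "vector_space scl" "c \<noteq> 0"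
  shows "line scl (scl c a) = line scl a"
proof -
  interpret vector_space scl
    by fact
  have "scl t a \<in> range (\<lambda>t. scl t (scl c a))" for t
    by (rule range_eqI[of _ _ "t / c"]) (simp add: \<open>c \<noteq> 0\<close>)
  moreover have "scl t (scl c a) \<in> range (\<lambda>t. scl t a)" for t
    by (rule range_eqI[of _ _ "t * c"]) simp
  ultimately show ?thesis
    unfolding line_def by blast
qed

lemma line_eqD:
  assumes "vector_space scl" "line scl a = line scl b" "a \<noteq> 0"
  shows "\<exists>c. c \<noteq> 0 \<and> a = scl c b"
proof -
  interpret vector_space scl
    by fact
  have "a \<in> line scl a"
    unfolding line_def by (metis rangeI scale_one)
  then obtain c where "a = scl c b"
    using assms(2) by (auto simp: line_def)
  with assms(3) show ?thesis
    by auto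
qed

context symmetric_composition_algebra
begin

lemma orthogonality_graph_arcE:
  assumes "(u, v) \<in> parcs (orthogonality_graph scl mul)"
  obtains a b where "u = line scl a" "v = line scl b" "a \<noteq> 0" "b \<noteq> 0" "a \<bottom> b" "line scl a \<noteq> line scl b"
    "a \<in> two_sided_zero_divisors mul" "b \<in> two_sided_zero_divisors mul"
proof -
  obtain a b where ab: "u = line scl a" "v = line scl b" "a \<in> two_sided_zero_divisors mul"
    "b \<in> two_sided_zero_divisors mul" "line scl a \<noteq> line scl b" "a \<odot> b = 0" "b \<odot> a = 0"
    using assms by (auto simp: orthogonality_graph_def)
  moreover from ab have "a \<noteq> 0" "b \<noteq> 0"
    by (simp_all add: two_sided_zero_divisors_def left_zero_divisor_def)
  ultimately show ?thesis
    using that by (simp add: orthogonal_def)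
qed

lemma orthogonality_graph_clique_core:
  assumes triple: "\<And>x y z. square_zero x \<Longrightarrow> square_zero y \<Longrightarrow> square_zero z \<Longrightarrow> x \<bottom> y \<Longrightarrow> x \<bottom> z \<Longrightarrow>
    x \<noteq> 0 \<Longrightarrow> y \<notin> span {x} \<Longrightarrow> z \<in> span {x, y}"
  shows "clique_core_digraph (orthogonality_graph scl mul) (line scl ` {x. x \<noteq> 0 \<and> square_zero x})"
    (is "clique_core_digraph ?G ?C")
proof
  have vs: "vector_space scl"
    by unfold_locales
  have arcI: "(line scl a, line scl b) \<in> parcs ?G"
    if "a \<in> two_sided_zero_divisors mul" "b \<in> two_sided_zero_divisors mul"
      "line scl a \<noteq> line scl b" "a \<bottom> b" for a b
    using that by (auto simp: orthogonality_graph_def orthogonal_def)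
  have core: "line scl a \<in> ?C \<longleftrightarrow> square_zero a" if a: "a \<noteq> 0" for a
  proof
    assume "line scl a \<in> ?C"
    then obtain x where "square_zero x" "line scl a = line scl x"
      by auto
    moreover from this obtain c where "a = c *\<^sub>F x"
      using line_eqD[OF vs _ a] by blast
    ultimately show "square_zero a"
      by (simp add: square_zero_def mul_linear)
  qed (use a in auto)
  \<comment> \<open>Each arc brings its own generator of a shared vertex; this transfers
    orthogonality to a fixed generator.\<close>
  have same_line: "a \<bottom> c" if "a' \<bottom> c" "line scl a = line scl a'" "a \<noteq> 0" for a a' c
    using line_eqD[OF vs that(2,3)] that(1) by (auto simp: orthogonal_def mul_linear)
  show "fst e \<in> pverts ?G" "snd e \<in> pverts ?G" if "e \<in> parcs ?G" for e
    using that by (auto simp: orthogonality_graph_def)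
  show "(v, u) \<in> parcs ?G" if "(u, v) \<in> parcs ?G" for u v
    using that by (auto simp: orthogonality_graph_def)
  show "v = w" if u: "u \<notin> ?C" and uv: "(u, v) \<in> parcs ?G" and uw: "(u, w) \<in> parcs ?G" for u v w
  proof -
    obtain a b where ab: "u = line scl a" "v = line scl b" "a \<noteq> 0" "b \<noteq> 0" "a \<bottom> b"
      using orthogonality_graph_arcE[OF uv] by metis
    obtain a' c where ac: "u = line scl a'" "w = line scl c" "c \<noteq> 0" "a' \<bottom> c"
      using orthogonality_graph_arcE[OF uw] by metis
    have "a \<odot> a \<noteq> 0"
      using u core[OF ab(3)] ab(1) by (simp add: square_zero_def)
    moreover have "a \<bottom> c"
      using same_line[OF ac(4), of a] ab ac by simp
    ultimately obtain s t where "b = s *\<^sub>F (a \<odot> a)" "c = t *\<^sub>F (a \<odot> a)"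
      using orthogonal_to_square[of a b] orthogonal_to_square[of a c] ab(5) by auto
    then show ?thesis
      using ab(2,4) ac(2,3) line_scale[OF vs] by auto
  qed
  show "(u, w) \<in> parcs ?G"
    if uv: "(u, v) \<in> parcs ?G" and vw: "(v, w) \<in> parcs ?G"
      and C: "u \<in> ?C" "v \<in> ?C" "w \<in> ?C" and "u \<noteq> w" for u v w
  proof -
    obtain a b where ab: "u = line scl a" "v = line scl b" "a \<noteq> 0" "b \<noteq> 0" "a \<bottom> b"
      "line scl a \<noteq> line scl b" "a \<in> two_sided_zero_divisors mul"
      using orthogonality_graph_arcE[OF uv] by metis
    obtain b' c where bc: "v = line scl b'" "w = line scl c" "c \<noteq> 0" "b' \<bottom> c"
      "c \<in> two_sided_zero_divisors mul"
      using orthogonality_graph_arcE[OF vw] by metis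
    have sq: "square_zero a" "square_zero b" "square_zero c"
      using C ab bc core by simp_all
    have "b \<bottom> c"
      using same_line[OF bc(4), of b] ab bc by simp
    have "a \<notin> span {b}"
    proof
      assume "a \<in> span {b}"
      then obtain s where "a = s *\<^sub>F b"
        by (auto simp: span_singleton)
      with ab(3,6) line_scale[OF vs] show False
        by auto
    qed
    \<comment> \<open>The middle vertex b takes the role of x, being orthogonal to both others. As a
      is orthogonal to b and to itself, it is then orthogonal to c.\<close>
    then have "c \<in> span {b, a}"
      using triple[OF sq(2,1,3)] ab \<open>b \<bottom> c\<close> by (simp add: orthogonal_sym)
    then have "a \<bottom> c"
      using ab(5) sq(1) by (auto simp: span_pair orthogonal_def square_zero_def mul_linear)
    then show ?thesis
      using arcI[of a c] ab bc \<open>u \<noteq> w\<close> by simp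
  qed
qed

end

theorem proposition4p1:
  fixes scl :: "'f::field \<Rightarrow> 'v::ab_group_add \<Rightarrow> 'v"
    and mul :: "'v \<Rightarrow> 'v \<Rightarrow> 'v"
  assumes okubo: "isotropic_okubo_algebra scl mul"
    and cond:
      "\<not> (\<exists>e. e \<noteq> 0 \<and> idempotent mul e) \<or>
       (CHAR('f) \<noteq> 3 \<and> \<not> (\<exists>w::'f. primitive_root_of_unity 3 w)) \<or>
       (CHAR('f) = 3 \<and> \<not> split_okubo_algebra scl mul)"
  shows
    "\<forall>x \<in> zero_divisors mul. \<forall>y \<in> zero_divisors mul. \<forall>k::nat.
       graph_distance (orthogonality_graph scl mul) (line scl x) (line scl y) = ereal (real k) \<longrightarrow>
       (\<exists>!p. path_of_length (orthogonality_graph scl mul) k (line scl x) p (line scl y))"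
proof -
  obtain \<alpha> \<beta> f where alg: "nonassoc_algebra scl mul" and "\<alpha> \<noteq> 0" "\<beta> \<noteq> 0"
    and f: "Vector_Spaces.linear scl (*s) f" "bij f"
    and f_mul: "\<And>a b. f (mul a b) = okubo_mult \<alpha> \<beta> (f a) (f b)"
    using okubo unfolding isotropic_okubo_algebra_def algebra_isomorphic_def by blast
  interpret f: Vector_Spaces.linear scl "(*s)" f
    by fact
  interpret symmetric_composition_algebra scl mul "\<lambda>x. okubo_norm \<alpha> \<beta> (f x)"
    "\<lambda>x y. okubo_polar \<alpha> \<beta> (f x) (f y)"
    using alg f f_mul \<open>\<alpha> \<noteq> 0\<close> \<open>\<beta> \<noteq> 0\<close> by (rule symmetric_composition_algebra_pullback)
  \<comment> \<open>The coordinate identity is carried back through the injective map f.\<close>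
  have cyclic: "mul (mul x y) z + mul (mul y z) x + mul (mul z x) y
      = mul z (mul x y) + mul x (mul y z) + mul y (mul z x)" for x y z
    using okubo_mult_cyclic[of \<alpha> \<beta> "f x" "f y" "f z"] bij_is_inj[OF f(2)]
    by (simp add: inj_eq flip: f_mul f.add)
  have "z \<in> module.span scl {x, y}"
    if xyz: "square_zero x" "square_zero y" "square_zero z" "orthogonal x y" "orthogonal x z"
      "x \<noteq> 0" "y \<notin> module.span scl {x}" for x y z
  proof (rule ccontr)
    assume z: "z \<notin> module.span scl {x, y}"
    consider (idem) "\<not> (\<exists>e. e \<noteq> 0 \<and> idempotent mul e)"
      | (root) "CHAR('f) \<noteq> 3" "\<not> (\<exists>w::'f. primitive_root_of_unity 3 w)"
      | (char3) "CHAR('f) = 3" "\<not> split_okubo_algebra scl mul"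
      using cond by blast
    then show False
    proof cases
      case idem
      then show False
        using square_zero_imp_idempotent xyz by blast
    next
      case root
      then show False
        using orthogonal_pair_imp_root[OF cyclic xyz(1,2,4,6,7)] primitive_cube_root_from_quadratic
        by blast
    next
      case char3
      then have three: "(3 :: 'f) = 0"
        using of_nat_CHAR[where 'a = 'f] by simp
      obtain \<delta> where \<delta>: "\<And>v. \<exists>s t. cubic v = s ^ 3 * \<delta> + t ^ 3"
        using cubic_range[OF three xyz z] by blast
      have f_inv: "f (inv f v) = v" for v
        using f(2) by (simp add: bij_is_surj surj_f_inv_f)
      \<comment> \<open>The square of \<open>z_{1,0}\<close> is \<open>z_{2,0}\<close>, which pairs
        with it to \<alpha>; the other values arise likewise. Each parameter thus occurs together
        with its square, as \<open>cube_of_cube_combinations\<close> requires.\<close>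
      have cubic_values: "cubic (inv f (axis Z10 1)) = \<alpha>" "cubic (inv f (axis Z20 1)) = \<alpha> * \<alpha>"
        "cubic (inv f (axis Z01 1)) = \<beta>" "cubic (inv f (axis Z02 1)) = \<beta> * \<beta>"
        unfolding cubic_def by (simp_all add: f_mul f_inv okubo_polar_eq okubo_mult_nth axis_def)
      have cube: "\<exists>a. c = a ^ 3" if "cubic u = c" "cubic v = c * c" for u v c
      proof -
        obtain s t s' t' where "cubic u = s ^ 3 * \<delta> + t ^ 3" "cubic v = s' ^ 3 * \<delta> + t' ^ 3"
          using \<delta> by blast
        then show ?thesis
          using cube_of_cube_combinations[OF three, of c s \<delta> t s' t'] that by simp
      qed
      obtain a where a: "\<alpha> = a ^ 3"
        using cube[OF cubic_values(1,2)] by blast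
      obtain b where b: "\<beta> = b ^ 3"
        using cube[OF cubic_values(3,4)] by blast
      have "a \<noteq> 0" "b \<noteq> 0"
        using a b \<open>\<alpha> \<noteq> 0\<close> \<open>\<beta> \<noteq> 0\<close> by auto
      have "Vector_Spaces.linear scl (*s) (okubo_rescale a b \<circ> f)"
        using f(1) okubo_rescale_linear by (rule Vector_Spaces.linear_compose)
      moreover have "bij (okubo_rescale a b \<circ> f)"
        using f(2) okubo_rescale_bij[OF \<open>a \<noteq> 0\<close> \<open>b \<noteq> 0\<close>] by (rule bij_comp)
      moreover have "(okubo_rescale a b \<circ> f) (mul u v)
          = okubo_mult 1 1 ((okubo_rescale a b \<circ> f) u) ((okubo_rescale a b \<circ> f) v)" for u v
        by (simp add: f_mul a b okubo_rescale_mult)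
      ultimately have "split_okubo_algebra scl mul"
        unfolding split_okubo_algebra_def algebra_isomorphic_def using alg by blast
      with char3 show False
        by blast
    qed
  qed
  then interpret clique_core_digraph "orthogonality_graph scl mul"
    "line scl ` {x. x \<noteq> 0 \<and> square_zero x}"
    by (rule orthogonality_graph_clique_core)
  show ?thesis
    using unique_shortest_path by blast
qed

end
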